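(* Let $\alpha\in(0,1/2)$ and let $G$ be the random graph on $n$ vertices with types $x_1,\dots,x_n$ i.i.d. uniform on $[\alpha,1-\alpha]$ in which, given the types, each pair $ij$ is joined independently with probability $W(x_i,x_j)$, where $W(x,y)=(x+y)/2$. Then the map $x\mapsto1-x$ on types composed with graph complementation preserves the law of $G$. Consequently, writing $X_{k,d}$ for the number of $d$-regular induced subgraphs of order $k$ of $G$, $\mathbb E X_{k,d}=\mathbb E X_{k,k-1-d}$, and for any bound on $\sum_d\mathbb E X_{k,d}$ it suffices to treat $d\le(k-1)/2$, i.e. $\lambda\le1/2$, where $\lambda=d/(k-1)$. More generally, let $0<p_0<1/2$ and let $W:[0,1]^2\to[p_0,1-p_0]$ be symmetric and Lipschitz with least Lipschitz constant $L$. Then the kernel $\widetilde W(x,y):=1-W(1-x,1-y)$ lies in the same family (same $p_0$ and $L$), and the complement of $\mathcal G(n,W)$ is distributed as $\mathcal G(n,\widetilde W)$; since a set induces a regular subgraph of $G$ if and only if it does so in the complement, family-wide statements may always be restricted to $\lambda\le1/2$.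
   Context: A graph is regular if all its degrees are equal. For a $d$-regular graph of order $k$, $\lambda=d/(k-1)$. Model $\mathcal G(n,W)$, for a symmetric Lipschitz kernel $W:[0,1]^2\to[p_0,1-p_0]$ with $0<p_0<1/2$ and least Lipschitz constant $L$: draw types $x_1,\dots,x_n$ i.i.d. uniform on $[0,1]$ and join $i\sim j$ independently with probability $W(x_i,x_j)$. "The family" is the family of all such models (kernels). In the second part, $G\sim\mathcal G(n,W)$. *)

theory Defs
  imports "HOL-Probability.Probability"
begin

text \<open>Simple graphs are given by a vertex set \<open>V\<close> and a set of edges, each edge being a
  two-element subset of \<open>V\<close>.\<close>

definition vertex_pairs :: "'a set \<Rightarrow> 'a set set" where
  "vertex_pairs V = {e. e \<subseteq> V \<and> card e = 2}"

definition compl_graph :: "'a set \<Rightarrow> 'a set set \<Rightarrow> 'a set set" where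
  "compl_graph V E = vertex_pairs V - E"

definition induced :: "'a set set \<Rightarrow> 'a set \<Rightarrow> 'a set set" where
  "induced E S = {e \<in> E. e \<subseteq> S}"

definition deg :: "'a set set \<Rightarrow> 'a \<Rightarrow> nat" where
  "deg E v = card {e \<in> E. v \<in> e}"

definition regular_graph :: "'a set \<Rightarrow> 'a set set \<Rightarrow> bool" where
  "regular_graph V E \<longleftrightarrow> (\<forall>u\<in>V. \<forall>v\<in>V. deg E u = deg E v)"

definition d_regular_graph :: "nat \<Rightarrow> 'a set \<Rightarrow> 'a set set \<Rightarrow> bool" where
  "d_regular_graph d V E \<longleftrightarrow> (\<forall>v\<in>V. deg E v = d)"

definition regular_sets :: "nat \<Rightarrow> nat \<Rightarrow> nat \<Rightarrow> nat set set \<Rightarrow> nat set set" where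
  "regular_sets n k d E = {S. S \<subseteq> {..<n} \<and> card S = k \<and> d_regular_graph d S (induced E S)}"

definition num_regular :: "nat \<Rightarrow> nat \<Rightarrow> nat \<Rightarrow> nat set set \<Rightarrow> nat" where
  "num_regular n k d E = card (regular_sets n k d E)"

text \<open>For \<open>k = 1\<close> the only degree is \<open>d = 0\<close>, and the value is \<open>0 / 0 = 0\<close>.\<close>

definition lam :: "nat \<Rightarrow> nat \<Rightarrow> real" where
  "lam k d = real d / (real k - 1)"

text \<open>The underlying space of the type distribution is the interval itself, not the whole real line,
  so that the values of a kernel outside the relevant square (where it need not even be measurable)
  play no role.\<close>

definition types_law :: "real \<Rightarrow> real \<Rightarrow> nat \<Rightarrow> (nat \<Rightarrow> real) measure" where
  "types_law a b n =
     (\<Pi>\<^sub>M i\<in>{..<n}. uniform_measure (restrict_space lborel {a..b}) {a..b})"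

text \<open>The conditional law of the edge set given the types. The kernels considered are symmetric, so
  ordering the endpoints of an edge by \<open>Min\<close> and \<open>Max\<close> is only a choice of representation.\<close>

definition edges_pmf :: "nat \<Rightarrow> (real \<Rightarrow> real \<Rightarrow> real) \<Rightarrow> (nat \<Rightarrow> real) \<Rightarrow> nat set set pmf" where
  "edges_pmf n W x =
     map_pmf (\<lambda>f. {e \<in> vertex_pairs {..<n}. f e})
       (Pi_pmf (vertex_pairs {..<n}) False (\<lambda>e. bernoulli_pmf (W (x (Min e)) (x (Max e)))))"

text \<open>Joint law of types and edge set, with types uniform on \<open>[a, b]\<close>.\<close>

definition typed_graph_law ::
  "real \<Rightarrow> real \<Rightarrow> nat \<Rightarrow> (real \<Rightarrow> real \<Rightarrow> real) \<Rightarrow> ((nat \<Rightarrow> real) \<times> nat set set) measure" where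
  "typed_graph_law a b n W =
     types_law a b n \<bind>
       (\<lambda>x. distr (measure_pmf (edges_pmf n W x)) (types_law a b n \<Otimes>\<^sub>M count_space UNIV)
               (\<lambda>E. (x, E)))"

definition graph_law ::
  "real \<Rightarrow> real \<Rightarrow> nat \<Rightarrow> (real \<Rightarrow> real \<Rightarrow> real) \<Rightarrow> nat set set measure" where
  "graph_law a b n W = distr (typed_graph_law a b n W) (count_space UNIV) snd"

definition expected_num ::
  "real \<Rightarrow> real \<Rightarrow> nat \<Rightarrow> (real \<Rightarrow> real \<Rightarrow> real) \<Rightarrow> nat \<Rightarrow> nat \<Rightarrow> real" where
  "expected_num a b n W k d = (\<integral>E. real (num_regular n k d E) \<partial>graph_law a b n W)"

definition regular_sets_law ::
  "real \<Rightarrow> real \<Rightarrow> nat \<Rightarrow> (real \<Rightarrow> real \<Rightarrow> real) \<Rightarrow> nat \<Rightarrow> nat \<Rightarrow> nat set set measure" where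
  "regular_sets_law a b n W k d =
     distr (graph_law a b n W) (count_space UNIV) (regular_sets n k d)"

text \<open>Kernels are total functions on the reals, constrained only on the unit square. The Lipschitz
  condition is with respect to the Euclidean distance on the square.\<close>

definition least_lipschitz :: "real \<Rightarrow> (real \<Rightarrow> real \<Rightarrow> real) \<Rightarrow> bool" where
  "least_lipschitz L W \<longleftrightarrow>
     L-lipschitz_on ({0..1} \<times> {0..1}) (\<lambda>(x, y). W x y) \<and>
     (\<forall>C. C-lipschitz_on ({0..1} \<times> {0..1}) (\<lambda>(x, y). W x y) \<longrightarrow> L \<le> C)"

definition kernel_family :: "real \<Rightarrow> real \<Rightarrow> (real \<Rightarrow> real \<Rightarrow> real) set" where
  "kernel_family p0 L =
     {W. (\<forall>x\<in>{0..1}. \<forall>y\<in>{0..1}. W x y = W y x \<and> W x y \<in> {p0..1 - p0}) \<and> least_lipschitz L W}"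

definition reflect_kernel :: "(real \<Rightarrow> real \<Rightarrow> real) \<Rightarrow> real \<Rightarrow> real \<Rightarrow> real" where
  "reflect_kernel W x y = 1 - W (1 - x) (1 - y)"

end

theory Submission
  imports Defs
begin

text \<open>
  Complementing an edge set turns an edge probability \<open>W (x i) (x j)\<close> into \<open>1 - W (x i) (x j)\<close>,
  and independence of the pairs is untouched. By definition this is the probability that the
  reflected kernel \<open>reflect_kernel W\<close> assigns to the reflected types \<open>1 - x i\<close> and \<open>1 - x j\<close>
  (\<open>complement_edges_pmf\<close>). When \<open>a + b = 1\<close> the reflection preserves the uniform law on \<open>{a..b}\<close>,
  hence also the law of the i.i.d. types (\<open>distr_types_law_reflect\<close>). Integrating the conditional
  identity over the types shows that reflection of the types together with complementation carries
  the joint law for \<open>W\<close> to the joint law for \<open>reflect_kernel W\<close> (\<open>typed_graph_law_complement\<close>).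
  Both statements of the theorem are instances: \<open>(x + y) / 2\<close> is its own reflection, so on
  \<open>[\<alpha>, 1 - \<alpha>]\<close> the law is preserved, and on \<open>[0, 1]\<close> the reflection stays in the kernel family because
  \<open>(x, y) \<mapsto> (1 - x, 1 - y)\<close> and \<open>t \<mapsto> 1 - t\<close> are isometries and both are involutions.

  The consequences for regular subgraphs rest on one count: inside a set \<open>S\<close>, the degrees of a
  vertex in a graph and in its complement add up to \<open>card S - 1\<close> (\<open>deg_complement\<close>). So \<open>d\<close> is
  exchanged with \<open>k - 1 - d\<close>, and \<open>\<lambda>\<close> with \<open>1 - \<lambda>\<close>. A family closed under reflection then
  transfers bounds, and all properties invariant under this exchange, from \<open>\<lambda> \<le> 1/2\<close> to the
  remaining degrees.

  Analysis enters only through measurability: the mixture over types is meaningful because the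
  edge law is a measurable function of the types, which follows from continuity of the kernel on
  the square (\<open>measurable_edges_pmf\<close>).
\<close>

section \<open>Independent families of Bernoulli variables\<close>

text \<open>\<open>bernoulli_pmf\<close> truncates its parameter to the unit interval. In terms of the truncated
  value, the symmetry \<open>p \<mapsto> 1 - p\<close> and the measurable dependence on \<open>p\<close> hold for every real \<open>p\<close>.\<close>

context
begin

interpretation pmf_as_function .

lemma pmf_bernoulli_clamp:
  "pmf (bernoulli_pmf p) b = (if b then min 1 (max 0 p) else 1 - min 1 (max 0 p))"
  by transfer simp

end

lemma bernoulli_pmf_complement: "bernoulli_pmf (1 - p) = map_pmf Not (bernoulli_pmf p)"
proof (rule pmf_eqI)
  fix b
  have "pmf (map_pmf Not (bernoulli_pmf p)) (\<not> (\<not> b)) = pmf (bernoulli_pmf p) (\<not> b)"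
    by (rule pmf_map_inj') (auto simp: inj_def)
  then show "pmf (bernoulli_pmf (1 - p)) b = pmf (map_pmf Not (bernoulli_pmf p)) b"
    by (auto simp: pmf_bernoulli_clamp min_def max_def)
qed

text \<open>A product of finitely many distributions on a finite type lives on finitely many functions, so
  the probability of an event is a finite sum of finite products of the given point masses. This
  makes it a measurable function of any parameter on which the point masses depend measurably.\<close>

lemma measurable_Pi_pmf:
  fixes p :: "'x \<Rightarrow> 'i \<Rightarrow> 'b::finite pmf"
  assumes A: "finite A"
    and p: "\<And>i b. i \<in> A \<Longrightarrow> (\<lambda>x. pmf (p x i) b) \<in> borel_measurable M"
  shows "(\<lambda>x. measure_pmf (Pi_pmf A d (p x))) \<in> M \<rightarrow>\<^sub>M subprob_algebra (count_space UNIV)"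
proof (rule measurable_subprob_algebra)
  fix X :: "('i \<Rightarrow> 'b) set"
  let ?D = "PiE_dflt A d (\<lambda>_. UNIV) :: ('i \<Rightarrow> 'b) set"
  have fin: "finite (X \<inter> ?D)"
    using A by (intro finite_Int disjI2 finite_PiE_dflt) auto
  have "emeasure (measure_pmf (Pi_pmf A d (p x))) X =
      ennreal (\<Sum>f\<in>X \<inter> ?D. \<Prod>i\<in>A. pmf (p x i) (f i))" for x
  proof -
    have "emeasure (measure_pmf (Pi_pmf A d (p x))) X =
        emeasure (measure_pmf (Pi_pmf A d (p x))) (X \<inter> ?D)"
      using set_Pi_pmf_subset[OF A, of d "p x"]
      by (intro emeasure_eq_AE AE_pmfI) (auto simp: PiE_dflt_def)
    also have "\<dots> = ennreal (\<Sum>f\<in>X \<inter> ?D. pmf (Pi_pmf A d (p x)) f)"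
      using fin by (simp add: emeasure_measure_pmf_finite sum_ennreal)
    also have "(\<Sum>f\<in>X \<inter> ?D. pmf (Pi_pmf A d (p x)) f) =
        (\<Sum>f\<in>X \<inter> ?D. \<Prod>i\<in>A. pmf (p x i) (f i))"
      using A by (intro sum.cong refl pmf_Pi') (auto simp: PiE_dflt_def)
    finally show ?thesis .
  qed
  then show "(\<lambda>x. emeasure (measure_pmf (Pi_pmf A d (p x))) X) \<in> borel_measurable M"
    using p by simp
qed (auto intro: prob_space_imp_subprob_space prob_space_measure_pmf)

section \<open>Reflection of the types and complementation of the edges\<close>

lemma finite_vertex_pairs: "finite V \<Longrightarrow> finite (vertex_pairs V)"
  unfolding vertex_pairs_def by simp

abbreviation (input) reflect_types :: "nat \<Rightarrow> (nat \<Rightarrow> real) \<Rightarrow> nat \<Rightarrow> real" where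
  "reflect_types n x \<equiv> (\<lambda>i\<in>{..<n}. 1 - x i)"

lemma vertex_pairs_Min_Max:
  assumes "e \<in> vertex_pairs {..<n::nat}"
  shows "Min e < n" "Max e < n"
proof -
  from assms have "finite e" "e \<noteq> {}" "e \<subseteq> {..<n}"
    by (auto simp: vertex_pairs_def intro: finite_subset)
  then show "Min e < n" "Max e < n"
    using Min_in[of e] Max_in[of e] by blast+
qed

text \<open>The complement of a coordinatewise random set negates every coordinate, and negation turns a
  Bernoulli variable with parameter \<open>p\<close> into one with parameter \<open>1 - p\<close>.\<close>

lemma complement_edges_pmf:
  "map_pmf (compl_graph {..<n}) (edges_pmf n W x) =
     edges_pmf n (reflect_kernel W) (reflect_types n x)"
proof -
  let ?P = "vertex_pairs {..<n}"
  let ?b = "\<lambda>e. bernoulli_pmf (W (x (Min e)) (x (Max e)))"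
  have fin: "finite ?P" by (simp add: finite_vertex_pairs)
  have "edges_pmf n (reflect_kernel W) (reflect_types n x) =
      map_pmf (\<lambda>f. {e \<in> ?P. f e}) (Pi_pmf ?P False (\<lambda>e. map_pmf Not (?b e)))"
    unfolding edges_pmf_def
    by (intro arg_cong[where f = "map_pmf _"] Pi_pmf_cong refl)
       (simp add: reflect_kernel_def vertex_pairs_Min_Max
          bernoulli_pmf_complement)
  \<comment> \<open>Negating the coordinates also negates the default value outside of the vertex pairs; resetting
    it to \<open>False\<close> leaves the selected edges unchanged.\<close>
  also have "Pi_pmf ?P False (\<lambda>e. map_pmf Not (?b e)) =
      map_pmf (\<lambda>f. Not \<circ> f) (Pi_pmf ?P True ?b)"
    using fin by (rule Pi_pmf_map) simp
  also have "Pi_pmf ?P True ?b =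
      map_pmf (\<lambda>f e. if e \<in> ?P then f e else True) (Pi_pmf ?P False ?b)"
    using fin by (rule Pi_pmf_default_swap[symmetric])
  finally have eq: "edges_pmf n (reflect_kernel W) (reflect_types n x) =
      map_pmf (\<lambda>f. {e \<in> ?P. f e}) (map_pmf (\<lambda>f. Not \<circ> f)
        (map_pmf (\<lambda>f e. if e \<in> ?P then f e else True) (Pi_pmf ?P False ?b)))" .
  show ?thesis
    unfolding eq unfolding edges_pmf_def map_pmf_comp
    by (intro arg_cong2[where f = map_pmf] ext refl) (auto simp: compl_graph_def)
qed

lemma edges_pmf_subset:
  "E \<in> set_pmf (edges_pmf n W x) \<Longrightarrow> E \<subseteq> vertex_pairs {..<n}"
  by (auto simp: edges_pmf_def)

abbreviation uniform_type :: "real \<Rightarrow> real \<Rightarrow> real measure" where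
  "uniform_type a b \<equiv> uniform_measure (restrict_space lborel {a..b}) {a..b}"

lemma prob_space_uniform_type:
  assumes "a < b"
  shows "prob_space (uniform_type a b)"
  using assms by (intro prob_space_uniform_measure) (auto simp: emeasure_restrict_space)

lemma sets_uniform_type: "sets (uniform_type a b) = sets (restrict_space borel {a..b})"
  by (simp add: sets_restrict_space)

lemma space_uniform_type: "space (uniform_type a b) = {a..b}"
  by (simp add: space_restrict_space)

lemma measurable_uniform_type_reflect:
  assumes "a + b = 1"
  shows "(\<lambda>t. 1 - t) \<in> uniform_type a b \<rightarrow>\<^sub>M uniform_type a b"
proof -
  have "(\<lambda>t. 1 - t) \<in> restrict_space borel {a..b} \<rightarrow>\<^sub>M restrict_space borel {a..b}"
    using assms by (intro measurable_restrict_space3) auto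
  then show ?thesis
    by (simp only: measurable_cong_sets[OF sets_uniform_type sets_uniform_type])
qed

text \<open>Lebesgue measure is invariant under \<open>t \<mapsto> 1 - t\<close>, and for \<open>a + b = 1\<close> this map sends the
  interval \<open>{a..b}\<close> onto itself.\<close>

lemma distr_uniform_type_reflect:
  assumes ab: "a < b" "a + b = 1"
  shows "distr (uniform_type a b) (uniform_type a b) (\<lambda>t. 1 - t) = uniform_type a b"
proof (rule measure_eqI)
  let ?U = "uniform_type a b" and ?R = "restrict_space lborel {a..b}"
  have sp: "space ?U = {a..b}" by (rule space_uniform_type)
  note meas = measurable_uniform_type_reflect[OF ab(2)]
  fix A assume "A \<in> sets (distr ?U ?U (\<lambda>t. 1 - t))"
  then have A: "A \<in> sets ?R" by simp
  then have AB: "A \<in> sets borel" "A \<subseteq> {a..b}"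
    by (auto simp: sets_restrict_space_iff)
  let ?A' = "(\<lambda>t. 1 - t) -` A \<inter> space ?U"
  have A': "?A' \<in> sets ?R" using measurable_sets[OF meas, of A] A by simp
  have eqA': "?A' = (\<lambda>t. 1 - t) -` A" using AB(2) ab by (auto simp: sp)
  have lb: "distr lborel borel (\<lambda>t. 1 - t) = (lborel :: real measure)"
    by (subst (2) lborel_real_affine[of "-1" 1]) (auto simp: density_1 one_ennreal_def[symmetric])
  have "emeasure lborel A = emeasure (distr lborel borel (\<lambda>t. 1 - t)) A"
    by (simp only: lb)
  also have "\<dots> = emeasure lborel ((\<lambda>t. 1 - t) -` A)"
    using AB by (subst emeasure_distr) auto
  finally have leb: "emeasure lborel A = emeasure lborel ?A'" by (simp only: eqA')
  have "emeasure ?U B = emeasure lborel B / emeasure ?R {a..b}" if "B \<in> sets ?R" for B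
  proof -
    have "B \<subseteq> {a..b}" using that by (auto simp: sets_restrict_space_iff)
    then have "{a..b} \<inter> B = B" by blast
    moreover have "{a..b} \<in> sets ?R" by (simp add: sets_restrict_space_iff)
    ultimately show ?thesis
      using that \<open>B \<subseteq> {a..b}\<close> by (simp add: emeasure_restrict_space)
  qed
  from this[OF A] this[OF A'] leb
  show "emeasure (distr ?U ?U (\<lambda>t. 1 - t)) A = emeasure ?U A"
    using A by (subst emeasure_distr[OF meas]) simp_all
qed simp

lemma distr_types_law_reflect:
  assumes "a < b" "a + b = 1"
  shows "distr (types_law a b n) (types_law a b n) (reflect_types n) = types_law a b n"
proof -
  let ?U = "uniform_type a b"
  have "distr (types_law a b n) (types_law a b n) (compose {..<n} (\<lambda>t. 1 - t)) =
      (\<Pi>\<^sub>M i\<in>{..<n}. distr ?U ?U (\<lambda>t. 1 - t))"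
    unfolding types_law_def
    by (rule distr_PiM_finite_prob_space')
       (auto simp: measurable_uniform_type_reflect prob_space_uniform_type assms)
  then show ?thesis
    by (simp add: distr_uniform_type_reflect[OF assms] types_law_def[symmetric]
        compose_def[abs_def])
qed

section \<open>Measurability of the edge law in the types\<close>

lemma space_types_law: "space (types_law a b n) = ({..<n} \<rightarrow>\<^sub>E {a..b})"
  unfolding types_law_def space_PiM space_uniform_type ..

lemma space_types_law_nonempty: "a < b \<Longrightarrow> space (types_law a b n) \<noteq> {}"
  by (auto simp: space_types_law PiE_eq_empty_iff)

text \<open>Nothing is known about the kernel off the square, so the pair of types is regarded as a random
  element of the square, where the kernel is continuous.\<close>

lemma measurable_kernel_at_types:
  assumes W: "continuous_on ({a..b} \<times> {a..b}) (\<lambda>(x, y). W x y)"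
    and ij: "i < n" "j < n"
  shows "(\<lambda>x. W (x i) (x j)) \<in> borel_measurable (types_law a b n)"
proof -
  have comp: "(\<lambda>x. x k) \<in> types_law a b n \<rightarrow>\<^sub>M restrict_space borel {a..b}" if "k < n" for k
    using measurable_component_singleton[of k "{..<n}" "\<lambda>_. uniform_type a b"] that
    unfolding types_law_def
    by (simp only: measurable_cong_sets[OF refl sets_uniform_type] lessThan_iff)
  have real: "(\<lambda>x. x k) \<in> borel_measurable (types_law a b n)" if "k < n" for k
    using comp[OF that] by (simp add: measurable_restrict_space2_iff)
  have "(\<lambda>x. (x i, x j)) \<in> types_law a b n \<rightarrow>\<^sub>M restrict_space borel ({a..b} \<times> {a..b})"
  proof (rule measurable_restrict_space2)
    show "(\<lambda>x. (x i, x j)) \<in> space (types_law a b n) \<rightarrow> {a..b} \<times> {a..b}"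
      using ij unfolding space_types_law by (blast intro: PiE_mem)
    show "(\<lambda>x. (x i, x j)) \<in> borel_measurable (types_law a b n)"
      using real ij by (intro borel_measurable_Pair)
  qed
  from measurable_compose[OF this borel_measurable_continuous_on_restrict[OF W]]
  show ?thesis by simp
qed

lemma measurable_edges_pmf:
  assumes "continuous_on ({a..b} \<times> {a..b}) (\<lambda>(x, y). W x y)"
  shows "(\<lambda>x. measure_pmf (edges_pmf n W x))
    \<in> types_law a b n \<rightarrow>\<^sub>M subprob_algebra (count_space UNIV)"
  unfolding edges_pmf_def map_pmf_rep_eq
proof (rule measurable_compose[OF measurable_Pi_pmf measurable_distr])
  fix e and c :: bool assume "e \<in> vertex_pairs {..<n}"
  then have [measurable]:
    "(\<lambda>x. W (x (Min e)) (x (Max e))) \<in> borel_measurable (types_law a b n)"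
    by (intro measurable_kernel_at_types assms vertex_pairs_Min_Max)
  show "(\<lambda>x. pmf (bernoulli_pmf (W (x (Min e)) (x (Max e)))) c)
      \<in> borel_measurable (types_law a b n)"
    by (cases c) (simp_all add: pmf_bernoulli_clamp)
qed (simp_all add: finite_vertex_pairs)

lemma measurable_typed_edges:
  assumes "continuous_on ({a..b} \<times> {a..b}) (\<lambda>(x, y). W x y)"
  shows "(\<lambda>x. distr (measure_pmf (edges_pmf n W x))
                (types_law a b n \<Otimes>\<^sub>M count_space UNIV) (\<lambda>E. (x, E)))
    \<in> types_law a b n \<rightarrow>\<^sub>M subprob_algebra (types_law a b n \<Otimes>\<^sub>M count_space UNIV)"
  by (rule measurable_distr2[OF _ measurable_edges_pmf[OF assms]]) simp

lemma sets_typed_graph_law: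
  "a < b \<Longrightarrow> sets (typed_graph_law a b n W) = sets (types_law a b n \<Otimes>\<^sub>M count_space UNIV)"
  unfolding typed_graph_law_def by (rule sets_bind) (simp_all add: space_types_law_nonempty)

section \<open>Laws of the complement\<close>

lemma continuous_on_reflect_kernel:
  assumes W: "continuous_on ({a..b} \<times> {a..b}) (\<lambda>(x, y). W x y)" and ab: "a + b = 1"
  shows "continuous_on ({a..b} \<times> {a..b}) (\<lambda>(x, y). reflect_kernel W x y)"
proof -
  let ?r = "\<lambda>p. (1 - fst p, 1 - snd p) :: real \<times> real"
  have "continuous_on ({a..b} \<times> {a..b}) ((\<lambda>(x, y). W x y) \<circ> ?r)"
  proof (rule continuous_on_compose)
    show "continuous_on ({a..b} \<times> {a..b}) ?r" by (intro continuous_intros)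
    show "continuous_on (?r ` ({a..b} \<times> {a..b})) (\<lambda>(x, y). W x y)"
      using ab by (intro continuous_on_subset[OF W]) auto
  qed
  then have "continuous_on ({a..b} \<times> {a..b}) (\<lambda>p. 1 - ((\<lambda>(x, y). W x y) \<circ> ?r) p)"
    by (rule continuous_on_diff[OF continuous_on_const])
  then show ?thesis
    by (simp add: reflect_kernel_def o_def case_prod_beta)
qed

lemma measurable_reflect_types:
  assumes "a + b = 1"
  shows "reflect_types n \<in> types_law a b n \<rightarrow>\<^sub>M types_law a b n"
  unfolding types_law_def
  using measurable_uniform_type_reflect[OF assms]
  by (intro measurable_restrict measurable_compose[OF measurable_component_singleton]) auto

lemma measurable_complement_typed:
  assumes "a + b = 1"
  shows "(\<lambda>(x, E). (reflect_types n x, compl_graph {..<n} E))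
    \<in> types_law a b n \<Otimes>\<^sub>M count_space UNIV \<rightarrow>\<^sub>M types_law a b n \<Otimes>\<^sub>M count_space UNIV"
  unfolding case_prod_beta
  by (intro measurable_Pair measurable_compose[OF measurable_fst measurable_reflect_types[OF assms]]
      measurable_compose[OF measurable_snd]) simp_all

text \<open>The joint law is a mixture of conditional laws over the types. Pushing the mixture forward
  pushes forward each conditional law, which gives the conditional law for the reflected kernel at
  the reflected types; the reflected types have the same law as the types themselves.\<close>

lemma typed_graph_law_complement:
  assumes ab: "a < b" "a + b = 1"
    and W: "continuous_on ({a..b} \<times> {a..b}) (\<lambda>(x, y). W x y)"
  shows "distr (typed_graph_law a b n W) (types_law a b n \<Otimes>\<^sub>M count_space UNIV)
           (\<lambda>(x, E). (reflect_types n x, compl_graph {..<n} E)) =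
         typed_graph_law a b n (reflect_kernel W)"
proof -
  let ?T = "types_law a b n"
  let ?N = "?T \<Otimes>\<^sub>M count_space (UNIV :: nat set set set)"
  let ?\<Phi> = "\<lambda>(x, E). (reflect_types n x, compl_graph {..<n} E)"
  let ?K = "\<lambda>W x. distr (measure_pmf (edges_pmf n W x)) ?N (\<lambda>E. (x, E))"
  have \<Phi>: "?\<Phi> \<in> ?N \<rightarrow>\<^sub>M ?N" by (rule measurable_complement_typed[OF ab(2)])
  have r: "reflect_types n \<in> ?T \<rightarrow>\<^sub>M ?T" by (rule measurable_reflect_types[OF ab(2)])
  have K: "?K V \<in> ?T \<rightarrow>\<^sub>M subprob_algebra ?N"
    if "continuous_on ({a..b} \<times> {a..b}) (\<lambda>(x, y). V x y)" for V
    using that by (rule measurable_typed_edges)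
  have ne: "space ?T \<noteq> {}" using ab(1) by (rule space_types_law_nonempty)
  have step: "distr (?K W x) ?N ?\<Phi> = ?K (reflect_kernel W) (reflect_types n x)"
    if x: "x \<in> space ?T" for x
  proof -
    have rx: "reflect_types n x \<in> space ?T" using measurable_space[OF r x] .
    have "?K (reflect_kernel W) (reflect_types n x) =
        distr (measure_pmf (edges_pmf n W x)) ?N
          (\<lambda>E. (reflect_types n x, compl_graph {..<n} E))"
      using rx unfolding complement_edges_pmf[symmetric] map_pmf_rep_eq
      by (subst distr_distr) (simp_all add: o_def space_pair_measure)
    moreover have "distr (?K W x) ?N ?\<Phi> =
        distr (measure_pmf (edges_pmf n W x)) ?N (?\<Phi> \<circ> (\<lambda>E. (x, E)))"
      using x by (intro distr_distr \<Phi>) (simp add: space_pair_measure)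
    ultimately show ?thesis by (simp add: o_def)
  qed
  have "distr (typed_graph_law a b n W) ?N ?\<Phi> = ?T \<bind> (\<lambda>x. distr (?K W x) ?N ?\<Phi>)"
    unfolding typed_graph_law_def by (rule distr_bind[OF K[OF W] ne \<Phi>])
  also have "\<dots> = ?T \<bind> (\<lambda>x. ?K (reflect_kernel W) (reflect_types n x))"
    by (intro bind_cong refl step)
  also have "\<dots> = distr ?T ?T (reflect_types n) \<bind> ?K (reflect_kernel W)"
    by (rule bind_distr[OF r K[OF continuous_on_reflect_kernel[OF W ab(2)]] ne, symmetric])
  also have "\<dots> = typed_graph_law a b n (reflect_kernel W)"
    unfolding distr_types_law_reflect[OF ab] typed_graph_law_def ..
  finally show ?thesis .
qed

lemma sets_graph_law [simp]: "sets (graph_law a b n W) = UNIV"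
  unfolding graph_law_def by simp

lemma space_graph_law [simp]: "space (graph_law a b n W) = UNIV"
  unfolding graph_law_def by simp

lemma measurable_snd_typed_graph_law:
  "a < b \<Longrightarrow> snd \<in> typed_graph_law a b n W \<rightarrow>\<^sub>M count_space UNIV"
  by (simp add: measurable_cong_sets[OF sets_typed_graph_law refl])

lemma graph_law_complement:
  assumes ab: "a < b" "a + b = 1"
    and W: "continuous_on ({a..b} \<times> {a..b}) (\<lambda>(x, y). W x y)"
  shows "distr (graph_law a b n W) (count_space UNIV) (compl_graph {..<n}) =
         graph_law a b n (reflect_kernel W)"
proof -
  let ?N = "types_law a b n \<Otimes>\<^sub>M count_space (UNIV :: nat set set set)"
  let ?\<Phi> = "\<lambda>(x, E). (reflect_types n x, compl_graph {..<n} E)"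
  let ?J = "typed_graph_law a b n W"
  have \<Phi>: "?\<Phi> \<in> ?J \<rightarrow>\<^sub>M ?N"
    using measurable_complement_typed[OF ab(2), of n]
    by (simp only: measurable_cong_sets[OF sets_typed_graph_law[OF ab(1)] refl])
  have "distr (graph_law a b n W) (count_space UNIV) (compl_graph {..<n}) =
      distr ?J (count_space UNIV) (compl_graph {..<n} \<circ> snd)"
    unfolding graph_law_def
    by (intro distr_distr measurable_snd_typed_graph_law ab) simp
  also have "compl_graph {..<n} \<circ> snd = snd \<circ> ?\<Phi>" by auto
  also have "distr ?J (count_space UNIV) (snd \<circ> ?\<Phi>) = distr (distr ?J ?N ?\<Phi>) (count_space UNIV) snd"
    by (intro distr_distr[symmetric] \<Phi>) simp
  also have "\<dots> = graph_law a b n (reflect_kernel W)"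
    unfolding typed_graph_law_complement[OF assms] graph_law_def ..
  finally show ?thesis .
qed

text \<open>The law of the graph is a measure on all sets of vertex sets. Degrees count arbitrary members of
  such a set, so complementation exchanges degrees only for genuine graphs; this lemma confines the
  later arguments to those.\<close>

lemma AE_graph_law_subset:
  assumes "a < b" "continuous_on ({a..b} \<times> {a..b}) (\<lambda>(x, y). W x y)"
  shows "AE E in graph_law a b n W. E \<subseteq> vertex_pairs {..<n}"
proof -
  let ?N = "types_law a b n \<Otimes>\<^sub>M count_space (UNIV :: nat set set set)"
  have pred: "Measurable.pred ?N (\<lambda>p. snd p \<subseteq> vertex_pairs {..<n})"
    by (rule measurable_compose[OF measurable_snd]) simp
  have "AE p in typed_graph_law a b n W. snd p \<subseteq> vertex_pairs {..<n}"
    unfolding typed_graph_law_def AE_bind[OF measurable_typed_edges[OF assms(2)] pred]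
  proof (rule AE_I2)
    fix x assume x: "x \<in> space (types_law a b n)"
    have "AE E in measure_pmf (edges_pmf n W x). snd (x, E) \<subseteq> vertex_pairs {..<n}"
      by (auto intro: AE_pmfI dest: edges_pmf_subset)
    moreover have "(\<lambda>E. (x, E)) \<in> measure_pmf (edges_pmf n W x) \<rightarrow>\<^sub>M ?N"
      using x by (simp add: space_pair_measure)
    ultimately show "AE p in distr (measure_pmf (edges_pmf n W x)) ?N (\<lambda>E. (x, E)).
        snd p \<subseteq> vertex_pairs {..<n}"
      using pred by (subst AE_distr_iff) (auto simp: pred_def)
  qed
  then show ?thesis
    unfolding graph_law_def
    by (subst AE_distr_iff) (simp_all add: measurable_snd_typed_graph_law assms(1))
qed

section \<open>Regular induced subgraphs of the complement\<close>

text \<open>Every vertex of \<open>S\<close> other than \<open>v\<close> is joined to \<open>v\<close> in exactly one of the two graphs.\<close>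

lemma deg_complement:
  assumes E: "E \<subseteq> vertex_pairs V" and S: "finite S" "S \<subseteq> V" and v: "v \<in> S"
  shows "deg (induced E S) v + deg (induced (compl_graph V E) S) v = card S - 1"
proof -
  let ?A = "{e \<in> induced E S. v \<in> e}" and ?B = "{e \<in> induced (compl_graph V E) S. v \<in> e}"
  have "?A \<union> ?B = {e \<in> vertex_pairs S. v \<in> e}"
    using E S by (auto simp: induced_def compl_graph_def vertex_pairs_def)
  also have "\<dots> = (\<lambda>u. {v, u}) ` (S - {v})"
    using v by (force simp: vertex_pairs_def card_2_iff)
  finally have union: "?A \<union> ?B = (\<lambda>u. {v, u}) ` (S - {v})" .
  have "finite (?A \<union> ?B)" unfolding union using S by simp
  then have "card ?A + card ?B = card (?A \<union> ?B)"
    by (intro card_Un_disjoint[symmetric]) (auto simp: induced_def compl_graph_def)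
  also have "\<dots> = card (S - {v})"
    unfolding union by (intro card_image) (auto simp: inj_on_def doubleton_eq_iff)
  finally show ?thesis
    using v by (simp add: deg_def card_Diff_singleton)
qed

lemma d_regular_complement:
  assumes E: "E \<subseteq> vertex_pairs V" and S: "finite S" "S \<subseteq> V" and d: "d < card S"
  shows "d_regular_graph d S (induced E S) \<longleftrightarrow>
    d_regular_graph (card S - 1 - d) S (induced (compl_graph V E) S)"
  unfolding d_regular_graph_def
proof (intro ball_cong refl)
  fix v assume "v \<in> S"
  from deg_complement[OF E S this] d
  show "deg (induced E S) v = d \<longleftrightarrow> deg (induced (compl_graph V E) S) v = card S - 1 - d"
    by linarith
qed

lemma regular_complement:
  assumes E: "E \<subseteq> vertex_pairs V" and S: "finite S" "S \<subseteq> V"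
  shows "regular_graph S (induced E S) \<longleftrightarrow> regular_graph S (induced (compl_graph V E) S)"
  unfolding regular_graph_def
proof (intro ball_cong refl)
  fix u v assume "u \<in> S" "v \<in> S"
  from this[THEN deg_complement[OF E S]]
  show "deg (induced E S) u = deg (induced E S) v \<longleftrightarrow>
      deg (induced (compl_graph V E) S) u = deg (induced (compl_graph V E) S) v"
    by linarith
qed

lemma regular_sets_complement:
  assumes "E \<subseteq> vertex_pairs {..<n}" "d < k"
  shows "regular_sets n k (k - 1 - d) (compl_graph {..<n} E) = regular_sets n k d E"
  unfolding regular_sets_def
  using assms d_regular_complement[OF assms(1)]
  by (intro Collect_cong conj_cong refl) (auto dest: finite_subset[OF _ finite_lessThan])

text \<open>A graph has the same \<open>d\<close>-regular sets as its complement has \<open>(k - 1 - d)\<close>-regular ones. This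
  holds for almost every outcome, so the two laws agree once the law for the reflected kernel is
  written as the law of the complement.\<close>

lemma regular_sets_law_reflect:
  assumes ab: "a < b" "a + b = 1"
    and W: "continuous_on ({a..b} \<times> {a..b}) (\<lambda>(x, y). W x y)"
    and d: "d < k"
  shows "regular_sets_law a b n W k d = regular_sets_law a b n (reflect_kernel W) k (k - 1 - d)"
proof -
  let ?G = "graph_law a b n W" and ?C = "count_space (UNIV :: nat set set set)"
  have "regular_sets_law a b n (reflect_kernel W) k (k - 1 - d) =
      distr ?G ?C (regular_sets n k (k - 1 - d) \<circ> compl_graph {..<n})"
    unfolding regular_sets_law_def graph_law_complement[OF ab W, symmetric]
    by (rule distr_distr) (simp_all add: measurable_def)
  also have "\<dots> = distr ?G ?C (regular_sets n k d)"
    using AE_graph_law_subset[OF ab(1) W, of n]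
  proof (intro distr_cong_AE refl, elim eventually_mono)
    fix E :: "nat set set" assume "E \<subseteq> vertex_pairs {..<n}"
    then show "(regular_sets n k (k - 1 - d) \<circ> compl_graph {..<n}) E = regular_sets n k d E"
      using regular_sets_complement d by simp
  qed (simp_all add: measurable_def)
  finally show ?thesis unfolding regular_sets_law_def ..
qed

lemma expected_num_eq_integral_law:
  "expected_num a b n W k d = (\<integral>F. real (card F) \<partial>regular_sets_law a b n W k d)"
  unfolding expected_num_def num_regular_def regular_sets_law_def
  by (rule integral_distr[symmetric]) (simp_all add: measurable_def)

lemma expected_num_reflect:
  assumes "a < b" "a + b = 1"
    and "continuous_on ({a..b} \<times> {a..b}) (\<lambda>(x, y). W x y)"
    and "d < k"
  shows "expected_num a b n W k d = expected_num a b n (reflect_kernel W) k (k - 1 - d)"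
  unfolding expected_num_eq_integral_law regular_sets_law_reflect[OF assms] ..

lemma expected_num_nonneg: "0 \<le> expected_num a b n W k d"
  unfolding expected_num_def by simp

section \<open>Restriction to the lower half of the degrees\<close>

lemma lam_le_half_iff:
  assumes "d < k"
  shows "lam k d \<le> 1 / 2 \<longleftrightarrow> real d \<le> (real k - 1) / 2"
proof (cases "k = 1")
  case False
  with assms have "real k - 1 > 0" by simp
  then show ?thesis by (simp add: lam_def divide_le_eq)
qed (use assms in \<open>simp add: lam_def\<close>)

text \<open>The substitution \<open>d \<mapsto> k - 1 - d\<close> maps the degrees above \<open>(k - 1) / 2\<close> to those strictly below.
  The strictness on one side avoids counting the fixed point \<open>d = (k - 1) / 2\<close> twice. The functions
  \<open>f\<close> and \<open>g\<close> stand for the expectations of two kernels that are reflections of each other.\<close>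

lemma sum_split_at_half:
  fixes f g :: "nat \<Rightarrow> real"
  assumes "\<And>d. d < k \<Longrightarrow> f d = g (k - 1 - d)"
  shows "(\<Sum>d<k. f d) =
    (\<Sum>d | d < k \<and> real d \<le> (real k - 1) / 2. f d) + (\<Sum>d | d < k \<and> real d < (real k - 1) / 2. g d)"
proof -
  let ?lo = "{d. d < k \<and> real d \<le> (real k - 1) / 2}"
  let ?hi = "{d. d < k \<and> (real k - 1) / 2 < real d}"
  have "sum f ?hi = (\<Sum>d | d < k \<and> real d < (real k - 1) / 2. g d)"
    using assms
    by (intro sum.reindex_bij_witness[of _ "\<lambda>d. k - 1 - d" "\<lambda>d. k - 1 - d"])
       (auto simp: of_nat_diff field_simps)
  moreover have "sum f (?lo \<union> ?hi) = sum f ?lo + sum f ?hi"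
    by (rule sum.union_disjoint) auto
  moreover have "?lo \<union> ?hi = {..<k}" by auto
  ultimately show ?thesis by metis
qed

lemma sum_le_twice_half_bound:
  fixes f g :: "nat \<Rightarrow> real"
  assumes fg: "\<And>d. d < k \<Longrightarrow> f d = g (k - 1 - d)" and nonneg: "\<And>d. 0 \<le> g d"
    and f: "(\<Sum>d | d < k \<and> lam k d \<le> 1 / 2. f d) \<le> B"
    and g: "(\<Sum>d | d < k \<and> lam k d \<le> 1 / 2. g d) \<le> B"
  shows "(\<Sum>d<k. f d) \<le> 2 * B"
proof -
  have "{d. d < k \<and> real d \<le> (real k - 1) / 2} = {d. d < k \<and> lam k d \<le> 1 / 2}"
    using lam_le_half_iff by auto
  moreover have "(\<Sum>d | d < k \<and> real d < (real k - 1) / 2. g d)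
      \<le> (\<Sum>d | d < k \<and> lam k d \<le> 1 / 2. g d)"
    using nonneg lam_le_half_iff by (intro sum_mono2) auto
  ultimately show ?thesis
    using sum_split_at_half[of k f g, OF fg] f g by simp
qed

section \<open>Closure of the kernel family under reflection\<close>

lemma lipschitz_reflect_kernel:
  assumes "C-lipschitz_on ({0..1} \<times> {0..1}) (\<lambda>(x, y). W x y)"
  shows "C-lipschitz_on ({0..1} \<times> {0..1}) (\<lambda>(x, y). reflect_kernel W x y)"
proof (rule lipschitz_onI)
  fix p q :: "real \<times> real" assume pq: "p \<in> {0..1} \<times> {0..1}" "q \<in> {0..1} \<times> {0..1}"
  let ?f = "\<lambda>(x, y). W x y" and ?r = "\<lambda>p. (1 - fst p, 1 - snd p) :: real \<times> real"
  have refl: "(\<lambda>(x, y). reflect_kernel W x y) z = 1 - ?f (?r z)" for z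
    by (simp add: reflect_kernel_def case_prod_beta)
  have one_minus: "dist (1 - s) (1 - t) = dist s t" for s t :: real
    by (simp add: dist_real_def abs_minus_commute)
  have "?r p \<in> {0..1} \<times> {0..1}" "?r q \<in> {0..1} \<times> {0..1}"
    using pq by (simp_all add: mem_Times_iff)
  then have "dist (?f (?r p)) (?f (?r q)) \<le> C * dist (?r p) (?r q)"
    by (rule lipschitz_onD[OF assms])
  also have "dist (?r p) (?r q) = dist p q"
    by (simp only: dist_prod_def fst_conv snd_conv one_minus)
  finally show "dist ((\<lambda>(x, y). reflect_kernel W x y) p) ((\<lambda>(x, y). reflect_kernel W x y) q)
      \<le> C * dist p q"
    by (simp only: refl one_minus)
qed (rule lipschitz_on_nonneg[OF assms])

lemma reflect_kernel_involution [simp]: "reflect_kernel (reflect_kernel W) = W"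
  by (simp add: reflect_kernel_def fun_eq_iff)

text \<open>Reflection preserves every Lipschitz constant and is an involution, so it preserves the set of
  all Lipschitz constants, and with it the least one.\<close>

lemma lipschitz_reflect_kernel_iff:
  "C-lipschitz_on ({0..1} \<times> {0..1}) (\<lambda>(x, y). reflect_kernel W x y) \<longleftrightarrow>
   C-lipschitz_on ({0..1} \<times> {0..1}) (\<lambda>(x, y). W x y)"
  using lipschitz_reflect_kernel[of C W] lipschitz_reflect_kernel[of C "reflect_kernel W"] by auto

lemma reflect_kernel_in_family:
  assumes "W \<in> kernel_family p0 L"
  shows "reflect_kernel W \<in> kernel_family p0 L"
proof -
  have "reflect_kernel W x y = reflect_kernel W y x \<and> reflect_kernel W x y \<in> {p0..1 - p0}"
    if "x \<in> {0..1}" "y \<in> {0..1}" for x y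
  proof -
    have "1 - x \<in> {0..1}" "1 - y \<in> {0..1}" using that by auto
    then have "W (1 - x) (1 - y) = W (1 - y) (1 - x)" "W (1 - x) (1 - y) \<in> {p0..1 - p0}"
      using assms unfolding kernel_family_def by blast+
    then show ?thesis by (simp add: reflect_kernel_def)
  qed
  moreover have "least_lipschitz L (reflect_kernel W)"
    using assms unfolding kernel_family_def least_lipschitz_def lipschitz_reflect_kernel_iff by blast
  ultimately show ?thesis
    unfolding kernel_family_def by blast
qed

lemma kernel_family_continuous:
  "W \<in> kernel_family p0 L \<Longrightarrow> continuous_on ({0..1} \<times> {0..1}) (\<lambda>(x, y). W x y)"
  unfolding kernel_family_def least_lipschitz_def
  by (blast intro: lipschitz_on_continuous_on)

section \<open>The mean kernel and the kernel family\<close>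

lemma mean_kernel_reflect: "reflect_kernel (\<lambda>x y. (x + y) / 2) = (\<lambda>x y. (x + y) / 2)"
  by (simp add: reflect_kernel_def fun_eq_iff field_simps)

lemma half_set_eq: "{d. d < k \<and> real d \<le> (real k - 1) / 2} = {d. d < k \<and> lam k d \<le> 1 / 2}"
  using lam_le_half_iff by auto

lemma mean_kernel_symmetric:
  fixes \<alpha> :: real and n :: nat
  assumes "\<alpha> < 1 / 2"
  defines "W \<equiv> \<lambda>x y :: real. (x + y) / 2"
  defines "J \<equiv> typed_graph_law \<alpha> (1 - \<alpha>) n W"
    and "G \<equiv> graph_law \<alpha> (1 - \<alpha>) n W"
    and "ex \<equiv> expected_num \<alpha> (1 - \<alpha>) n W"
  shows "distr J J (\<lambda>(x, E). (reflect_types n x, compl_graph {..<n} E)) = J"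
    and "distr G G (compl_graph {..<n}) = G"
    and "d < k \<Longrightarrow> ex k d = ex k (k - 1 - d)"
proof -
  have ab: "\<alpha> < 1 - \<alpha>" "\<alpha> + (1 - \<alpha>) = 1" using assms(1) by simp_all
  have W: "continuous_on ({\<alpha>..1 - \<alpha>} \<times> {\<alpha>..1 - \<alpha>}) (\<lambda>(x, y). W x y)"
    unfolding W_def case_prod_beta by (intro continuous_intros) simp
  have self: "reflect_kernel W = W" unfolding W_def by (rule mean_kernel_reflect)
  show "distr J J (\<lambda>(x, E). (reflect_types n x, compl_graph {..<n} E)) = J"
    using typed_graph_law_complement[OF ab W, of n] unfolding self J_def[symmetric]
    by (subst (asm) distr_cong[of J J _ J]) (simp_all add: J_def sets_typed_graph_law[OF ab(1)])
  show "distr G G (compl_graph {..<n}) = G"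
    using graph_law_complement[OF ab W, of n] unfolding self G_def[symmetric]
    by (subst (asm) distr_cong[of G G _ G]) (simp_all add: G_def)
  show "ex k d = ex k (k - 1 - d)" if "d < k"
    using expected_num_reflect[OF ab W that, of n] unfolding self ex_def .
qed

lemma expected_num_family_reflect:
  assumes "W \<in> kernel_family p0 L" "d < k"
  shows "expected_num 0 1 n W k d = expected_num 0 1 n (reflect_kernel W) k (k - 1 - d)"
  using assms by (intro expected_num_reflect kernel_family_continuous) simp_all

lemma regular_sets_law_family_reflect:
  assumes "W \<in> kernel_family p0 L" "d < k"
  shows "regular_sets_law 0 1 n W k d = regular_sets_law 0 1 n (reflect_kernel W) k (k - 1 - d)"
  using assms by (intro regular_sets_law_reflect kernel_family_continuous) simp_all

lemma lam_complement:
  assumes "d < k" "\<not> lam k d \<le> 1 / 2"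
  shows "lam k (k - 1 - d) \<le> 1 / 2"
proof -
  have "(real k - 1) / 2 < real d" using assms lam_le_half_iff by auto
  then have "real (k - 1 - d) \<le> (real k - 1) / 2"
    using assms(1) by (simp add: of_nat_diff field_simps)
  then show ?thesis using assms(1) by (subst lam_le_half_iff) auto
qed

text \<open>A degree \<open>d\<close> above the middle is handled by applying the hypothesis to the reflected kernel and
  the degree \<open>k - 1 - d\<close>: the law in question is literally the same measure.\<close>

lemma family_law_reduction:
  assumes Q: "\<And>d M. d < k \<Longrightarrow> Q d M \<longleftrightarrow> Q (k - 1 - d) M"
    and low: "\<And>W d. W \<in> kernel_family p0 L \<Longrightarrow> d < k \<Longrightarrow> lam k d \<le> 1 / 2 \<Longrightarrow>
      Q d (regular_sets_law 0 1 n W k d)"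
    and W: "W \<in> kernel_family p0 L" and d: "d < k"
  shows "Q d (regular_sets_law 0 1 n W k d)"
proof (cases "lam k d \<le> 1 / 2")
  case True
  then show ?thesis using low W d by blast
next
  case False
  have "Q (k - 1 - d) (regular_sets_law 0 1 n (reflect_kernel W) k (k - 1 - d))"
    using d by (intro low reflect_kernel_in_family[OF W] lam_complement[OF d False]) simp
  then show ?thesis
    using Q[OF d] regular_sets_law_family_reflect[OF W d] by simp
qed

lemma family_sum_reduction:
  assumes low: "\<And>W. W \<in> kernel_family p0 L \<Longrightarrow>
      (\<Sum>d | d < k \<and> lam k d \<le> 1 / 2. expected_num 0 1 n W k d) \<le> B"
    and W: "W \<in> kernel_family p0 L"
  shows "(\<Sum>d<k. expected_num 0 1 n W k d) \<le> 2 * B"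
  using expected_num_family_reflect[OF W] expected_num_nonneg
    low[OF W] low[OF reflect_kernel_in_family[OF W]]
  by (rule sum_le_twice_half_bound)

theorem lemma3p2:
  shows
    "(\<forall>(\<alpha>::real) (n::nat). 0 < \<alpha> \<and> \<alpha> < 1/2 \<longrightarrow>
       (let W = (\<lambda>x y. (x + y) / 2);
            J = typed_graph_law \<alpha> (1 - \<alpha>) n W;
            G = graph_law \<alpha> (1 - \<alpha>) n W;
            ex = expected_num \<alpha> (1 - \<alpha>) n W
        in distr J J (\<lambda>(x, E). (\<lambda>i\<in>{..<n}. 1 - x i, compl_graph {..<n} E)) = J \<and>
           distr G G (compl_graph {..<n}) = G \<and>
           (\<forall>k d. d < k \<longrightarrow> ex k d = ex k (k - 1 - d)) \<and>
           (\<forall>k\<ge>1.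
              {d. d < k \<and> real d \<le> (real k - 1) / 2} = {d. d < k \<and> lam k d \<le> 1/2} \<and>
              (\<Sum>d<k. ex k d) =
                (\<Sum>d | d < k \<and> real d \<le> (real k - 1) / 2. ex k d) +
                (\<Sum>d | d < k \<and> real d < (real k - 1) / 2. ex k d) \<and>
              (\<forall>B. (\<Sum>d | d < k \<and> lam k d \<le> 1/2. ex k d) \<le> B \<longrightarrow>
                   (\<Sum>d<k. ex k d) \<le> 2 * B))))
     \<and>
     (\<forall>(p0::real) (L::real). 0 < p0 \<and> p0 < 1/2 \<longrightarrow>
       (\<forall>W\<in>kernel_family p0 L.
          reflect_kernel W \<in> kernel_family p0 L \<and>
          (\<forall>n. distr (graph_law 0 1 n W) (count_space UNIV) (compl_graph {..<n}) =
                 graph_law 0 1 n (reflect_kernel W)) \<and>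
          (\<forall>n k d. d < k \<longrightarrow>
             regular_sets_law 0 1 n W k d =
               regular_sets_law 0 1 n (reflect_kernel W) k (k - 1 - d)) \<and>
          (\<forall>n k. (\<Sum>d<k. expected_num 0 1 n W k d) =
             (\<Sum>d | d < k \<and> real d \<le> (real k - 1) / 2. expected_num 0 1 n W k d) +
             (\<Sum>d | d < k \<and> real d < (real k - 1) / 2.
                expected_num 0 1 n (reflect_kernel W) k d))) \<and>
       (\<forall>(n::nat). \<forall>E\<subseteq>vertex_pairs {..<n}. \<forall>S\<subseteq>{..<n}.
          (regular_graph S (induced E S) \<longleftrightarrow>
           regular_graph S (induced (compl_graph {..<n} E) S)) \<and>
          (\<forall>d<card S. d_regular_graph d S (induced E S) \<longleftrightarrow>
             d_regular_graph (card S - 1 - d) S (induced (compl_graph {..<n} E) S))) \<and>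
       (\<forall>n k (Q :: nat \<Rightarrow> nat set set measure \<Rightarrow> bool).
          (\<forall>d<k. \<forall>M. Q d M \<longleftrightarrow> Q (k - 1 - d) M) \<longrightarrow>
          ((\<forall>W\<in>kernel_family p0 L. \<forall>d<k. Q d (regular_sets_law 0 1 n W k d)) \<longleftrightarrow>
           (\<forall>W\<in>kernel_family p0 L. \<forall>d<k. lam k d \<le> 1/2 \<longrightarrow>
              Q d (regular_sets_law 0 1 n W k d)))) \<and>
       (\<forall>n k B.
          (\<forall>W\<in>kernel_family p0 L.
             (\<Sum>d | d < k \<and> lam k d \<le> 1/2. expected_num 0 1 n W k d) \<le> B) \<longrightarrow>
          (\<forall>W\<in>kernel_family p0 L. (\<Sum>d<k. expected_num 0 1 n W k d) \<le> 2 * B)))"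
proof (rule conjI, goal_cases)
  case 1
  show ?case
  proof (intro allI impI, elim conjE)
    fix \<alpha> :: real and n :: nat
    assume "\<alpha> < 1 / 2"
    note sym = mean_kernel_symmetric[OF this, where n = n]
    let ?ex = "expected_num \<alpha> (1 - \<alpha>) n (\<lambda>x y. (x + y) / 2)"
    have twice: "(\<Sum>d<k. ?ex k d) \<le> 2 * B"
      if "(\<Sum>d | d < k \<and> lam k d \<le> 1 / 2. ?ex k d) \<le> B" for k B
      using sym(3) expected_num_nonneg that that by (rule sum_le_twice_half_bound)
    show "let W = (\<lambda>x y. (x + y) / 2);
            J = typed_graph_law \<alpha> (1 - \<alpha>) n W;
            G = graph_law \<alpha> (1 - \<alpha>) n W;
            ex = expected_num \<alpha> (1 - \<alpha>) n W
        in distr J J (\<lambda>(x, E). (\<lambda>i\<in>{..<n}. 1 - x i, compl_graph {..<n} E)) = J \<and>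
           distr G G (compl_graph {..<n}) = G \<and>
           (\<forall>k d. d < k \<longrightarrow> ex k d = ex k (k - 1 - d)) \<and>
           (\<forall>k\<ge>1.
              {d. d < k \<and> real d \<le> (real k - 1) / 2} = {d. d < k \<and> lam k d \<le> 1/2} \<and>
              (\<Sum>d<k. ex k d) =
                (\<Sum>d | d < k \<and> real d \<le> (real k - 1) / 2. ex k d) +
                (\<Sum>d | d < k \<and> real d < (real k - 1) / 2. ex k d) \<and>
              (\<forall>B. (\<Sum>d | d < k \<and> lam k d \<le> 1/2. ex k d) \<le> B \<longrightarrow>
                   (\<Sum>d<k. ex k d) \<le> 2 * B))"
      unfolding Let_def
      by (intro conjI allI impI sym half_set_eq sum_split_at_half twice)
  qed
next
  case 2
  show ?case
  proof (intro allI impI conjI ballI, goal_cases)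
    case (1 p0 L W)
    then show ?case by (intro reflect_kernel_in_family)
  next
    case (2 p0 L W n)
    show ?case
      by (rule graph_law_complement[OF _ _ kernel_family_continuous[OF 2(2)]]) simp_all
  next
    case (3 p0 L W n k d)
    show ?case by (rule regular_sets_law_family_reflect[OF 3(2,3)])
  next
    case (4 p0 L W n k)
    show ?case by (rule sum_split_at_half) (rule expected_num_family_reflect[OF 4(2)])
  next
    case (5 p0 L n E S)
    show ?case by (rule regular_complement[OF 5(2) finite_subset[OF 5(3) finite_lessThan] 5(3)])
  next
    case (6 p0 L n E S d)
    show ?case
      by (rule d_regular_complement[OF 6(2) finite_subset[OF 6(3) finite_lessThan] 6(3,4)])
  next
    case (7 p0 L n k Q)
    show ?case
    proof (intro iffI ballI allI impI, goal_cases)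
      case (2 W d)
      show ?case
        by (rule family_law_reduction[OF _ _ 2(2,3)]) (use 7(2) 2(1) in blast)+
    qed blast
  next
    case (8 p0 L n k B W)
    show ?case by (rule family_sum_reduction[OF _ 8(3)]) (use 8(2) in blast)
  qed
qed

end
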